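(* Let $T:V\to\mathfrak g$ be an $\mathcal O$-operator on a pre-Lie algebra $(\mathfrak g,\cdot_{\mathfrak g})$ associated to a representation $(V;\rho,\mu)$ and let $N$ be a Nijenhuis operator on $(\mathfrak g,\cdot_{\mathfrak g})$. Then $N\circ T$ is an $\mathcal O$-operator on $(\mathfrak g,\cdot_{\mathfrak g})$ associated to $(V;\rho,\mu)$ if and only if for all $u,v\in V$ $$N\Big(NT(u)\cdot_{\mathfrak g}T(v)+T(u)\cdot_{\mathfrak g}NT(v)\Big)=N\Big(T\big(\rho(NT(u))(v)+\mu(NT(v))(u)\big)+NT\big(\rho(T(u))(v)+\mu(T(v))(u)\big)\Big).$$ In this case, if in addition $N$ is invertible, then $T$ and $N\circ T$ are compatible. More explicitly, for any $\mathcal O$-operator $T$, if there exists an invertible Nijenhuis operator $N$ such that $N\circ T$ is also an $\mathcal O$-operator, then $T$ and $N\circ T$ are compatible.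
   Context: $\mathbb K$ is an algebraically closed field of characteristic $0$; vector spaces are finite dimensional over $\mathbb K$. A pre-Lie algebra is a vector space $\mathfrak g$ with a bilinear product $\cdot_{\mathfrak g}$ such that $(x\cdot_{\mathfrak g} y)\cdot_{\mathfrak g} z-x\cdot_{\mathfrak g}(y\cdot_{\mathfrak g} z)$ is symmetric in $x,y$; $[x,y]^c=x\cdot_{\mathfrak g}y-y\cdot_{\mathfrak g}x$ is then a Lie bracket. A representation $(V;\rho,\mu)$ consists of a vector space $V$, a representation $\rho:\mathfrak g\to\mathfrak{gl}(V)$ of the Lie algebra $(\mathfrak g,[\cdot,\cdot]^c)$ and a linear map $\mu:\mathfrak g\to\mathfrak{gl}(V)$ with $\rho(x)\mu(y)-\mu(y)\rho(x)=\mu(x\cdot_{\mathfrak g}y)-\mu(y)\mu(x)$ for all $x,y\in\mathfrak g$. A linear map $T:V\to\mathfrak g$ is an $\mathcal O$-operator associated to $(V;\rho,\mu)$ if $T(u)\cdot_{\mathfrak g}T(v)=T\big(\rho(T(u))(v)+\mu(T(v))(u)\big)$ for all $u,v\in V$. Two $\mathcal O$-operators $T_1,T_2$ associated to $(V;\rho,\mu)$ are compatible if $k_1T_1+k_2T_2$ is an $\mathcal O$-operator associated to $(V;\rho,\mu)$ for all $k_1,k_2\in\mathbb K$. A linear map $N:\mathfrak g\to\mathfrak g$ is a Nijenhuis operator if $N(x)\cdot_{\mathfrak g}N(y)=N\big(N(x)\cdot_{\mathfrak g}y+x\cdot_{\mathfrak g}N(y)-N(x\cdot_{\mathfrak g}y)\big)$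 for all $x,y$. *)

theory Defs
  imports Complex_Main "HOL-Computational_Algebra.Polynomial"
begin

text \<open>
  A vector space is a type together with a scalar multiplication, as in the library locale
  \<^locale>\<open>vector_space\<close>. The definitions work over any field and in any dimension.
\<close>

definition bilinear_map ::
  "('k::field \<Rightarrow> 'a::ab_group_add \<Rightarrow> 'a) \<Rightarrow> ('k \<Rightarrow> 'b::ab_group_add \<Rightarrow> 'b) \<Rightarrow>
   ('k \<Rightarrow> 'c::ab_group_add \<Rightarrow> 'c) \<Rightarrow> ('a \<Rightarrow> 'b \<Rightarrow> 'c) \<Rightarrow> bool" where
  "bilinear_map s1 s2 s3 f \<longleftrightarrow>
     (\<forall>y. Vector_Spaces.linear s1 s3 (\<lambda>x. f x y)) \<and> (\<forall>x. Vector_Spaces.linear s2 s3 (f x))"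

definition pre_lie_algebra ::
  "('k::field \<Rightarrow> 'g::ab_group_add \<Rightarrow> 'g) \<Rightarrow> ('g \<Rightarrow> 'g \<Rightarrow> 'g) \<Rightarrow> bool" where
  "pre_lie_algebra s m \<longleftrightarrow> bilinear_map s s s m \<and>
     (\<forall>x y z. m (m x y) z - m x (m y z) = m (m y x) z - m y (m x z))"

definition lie_algebra ::
  "('k::field \<Rightarrow> 'g::ab_group_add \<Rightarrow> 'g) \<Rightarrow> ('g \<Rightarrow> 'g \<Rightarrow> 'g) \<Rightarrow> bool" where
  "lie_algebra s b \<longleftrightarrow> bilinear_map s s s b \<and> (\<forall>x. b x x = 0) \<and>
     (\<forall>x y z. b x (b y z) + b y (b z x) + b z (b x y) = 0)"

definition commutator :: "('g::ab_group_add \<Rightarrow> 'g \<Rightarrow> 'g) \<Rightarrow> 'g \<Rightarrow> 'g \<Rightarrow> 'g" where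
  "commutator m x y = m x y - m y x"

text \<open>
  A linear map from \<open>\<gg>\<close> to \<open>\<gg>\<ll>(V)\<close> is given in uncurried form, as a map that is
  linear in the algebra argument and in the vector argument.
\<close>

definition lie_representation ::
  "('k::field \<Rightarrow> 'g::ab_group_add \<Rightarrow> 'g) \<Rightarrow> ('g \<Rightarrow> 'g \<Rightarrow> 'g) \<Rightarrow>
   ('k \<Rightarrow> 'v::ab_group_add \<Rightarrow> 'v) \<Rightarrow> ('g \<Rightarrow> 'v \<Rightarrow> 'v) \<Rightarrow> bool" where
  "lie_representation sg b sV \<rho> \<longleftrightarrow> bilinear_map sg sV sV \<rho> \<and>
     (\<forall>x y v. \<rho> (b x y) v = \<rho> x (\<rho> y v) - \<rho> y (\<rho> x v))"

definition pre_lie_representation ::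
  "('k::field \<Rightarrow> 'g::ab_group_add \<Rightarrow> 'g) \<Rightarrow> ('g \<Rightarrow> 'g \<Rightarrow> 'g) \<Rightarrow>
   ('k \<Rightarrow> 'v::ab_group_add \<Rightarrow> 'v) \<Rightarrow> ('g \<Rightarrow> 'v \<Rightarrow> 'v) \<Rightarrow> ('g \<Rightarrow> 'v \<Rightarrow> 'v) \<Rightarrow> bool" where
  "pre_lie_representation sg m sV \<rho> \<mu> \<longleftrightarrow>
     lie_representation sg (commutator m) sV \<rho> \<and> bilinear_map sg sV sV \<mu> \<and>
     (\<forall>x y v. \<rho> x (\<mu> y v) - \<mu> y (\<rho> x v) = \<mu> (m x y) v - \<mu> y (\<mu> x v))"

definition O_operator ::
  "('k::field \<Rightarrow> 'g::ab_group_add \<Rightarrow> 'g) \<Rightarrow> ('g \<Rightarrow> 'g \<Rightarrow> 'g) \<Rightarrow>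
   ('k \<Rightarrow> 'v::ab_group_add \<Rightarrow> 'v) \<Rightarrow> ('g \<Rightarrow> 'v \<Rightarrow> 'v) \<Rightarrow> ('g \<Rightarrow> 'v \<Rightarrow> 'v) \<Rightarrow>
   ('v \<Rightarrow> 'g) \<Rightarrow> bool" where
  "O_operator sg m sV \<rho> \<mu> T \<longleftrightarrow> Vector_Spaces.linear sV sg T \<and>
     (\<forall>u v. m (T u) (T v) = T (\<rho> (T u) v + \<mu> (T v) u))"

definition compatible_O_operators ::
  "('k::field \<Rightarrow> 'g::ab_group_add \<Rightarrow> 'g) \<Rightarrow> ('g \<Rightarrow> 'g \<Rightarrow> 'g) \<Rightarrow>
   ('k \<Rightarrow> 'v::ab_group_add \<Rightarrow> 'v) \<Rightarrow> ('g \<Rightarrow> 'v \<Rightarrow> 'v) \<Rightarrow> ('g \<Rightarrow> 'v \<Rightarrow> 'v) \<Rightarrow>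
   ('v \<Rightarrow> 'g) \<Rightarrow> ('v \<Rightarrow> 'g) \<Rightarrow> bool" where
  "compatible_O_operators sg m sV \<rho> \<mu> T1 T2 \<longleftrightarrow>
     O_operator sg m sV \<rho> \<mu> T1 \<and> O_operator sg m sV \<rho> \<mu> T2 \<and>
     (\<forall>k1 k2. O_operator sg m sV \<rho> \<mu> (\<lambda>v. sg k1 (T1 v) + sg k2 (T2 v)))"

definition nijenhuis_operator ::
  "('k::field \<Rightarrow> 'g::ab_group_add \<Rightarrow> 'g) \<Rightarrow> ('g \<Rightarrow> 'g \<Rightarrow> 'g) \<Rightarrow> ('g \<Rightarrow> 'g) \<Rightarrow> bool" where
  "nijenhuis_operator s m N \<longleftrightarrow> Vector_Spaces.linear s s N \<and>
     (\<forall>x y. m (N x) (N y) = N (m (N x) y + m x (N y) - N (m x y)))"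

lemma bilinear_mapD:
  assumes "bilinear_map s1 s2 s3 f"
  shows "f (x + x') y = f x y + f x' y" "f (x - x') y = f x y - f x' y"
    "f (s1 c x) y = s3 c (f x y)"
    "f x (y + y') = f x y + f x (y')" "f x (y - y') = f x y - f x y'"
    "f x (s2 c y) = s3 c (f x y)"
proof -
  interpret l: Vector_Spaces.linear s1 s3 "\<lambda>x. f x y" for y
    using assms by (simp add: bilinear_map_def)
  interpret r: Vector_Spaces.linear s2 s3 "f x" for x
    using assms by (simp add: bilinear_map_def)
  show "f (x + x') y = f x y + f x' y" "f (x - x') y = f x y - f x' y"
    "f (s1 c x) y = s3 c (f x y)"
    by (rule l.add l.diff l.scale)+
  show "f x (y + y') = f x y + f x (y')" "f x (y - y') = f x y - f x y'"
    "f x (s2 c y) = s3 c (f x y)"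
    by (rule r.add r.diff r.scale)+
qed

lemma pre_lie_algebra_commutator:
  assumes "pre_lie_algebra s m"
  shows "lie_algebra s (commutator m)"
proof -
  have b: "bilinear_map s s s m"
    and sym: "\<And>x y z. m (m x y) z - m x (m y z) = m (m y x) z - m y (m x z)"
    using assms by (auto simp: pre_lie_algebra_def)
  interpret vector_space s
    using b by (auto simp: bilinear_map_def Vector_Spaces.linear_def)
  have "bilinear_map s s s (commutator m)"
    unfolding bilinear_map_def commutator_def Vector_Spaces.linear_iff
    by (simp add: bilinear_mapD[OF b] scale_right_diff_distrib vector_space_axioms)
  moreover have "commutator m x (commutator m y z) + commutator m y (commutator m z x)
      + commutator m z (commutator m x y) = 0" for x y z
  proof -
    let ?a = "\<lambda>x y z. m (m x y) z - m x (m y z)"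
    have "commutator m x (commutator m y z) + commutator m y (commutator m z x)
        + commutator m z (commutator m x y)
      = (?a y x z - ?a x y z) + (?a z y x - ?a y z x) + (?a x z y - ?a z x y)"
      unfolding commutator_def bilinear_mapD[OF b] by (simp add: algebra_simps)
    also have "\<dots> = 0"
      by (simp only: sym[of y x z] sym[of z y x] sym[of x z y] diff_self add_0_left)
    finally show ?thesis .
  qed
  ultimately show ?thesis
    by (auto simp: lie_algebra_def commutator_def)
qed

end

theory Submission
  imports Defs
begin

text \<open>
  The defining identity of an \<open>\<O>\<close>-operator is quadratic in the operator, so for a combination
  \<open>k\<^sub>1 T\<^sub>1 + k\<^sub>2 T\<^sub>2\<close> of two \<open>\<O>\<close>-operators the terms in \<open>k\<^sub>1\<^sup>2\<close> and \<open>k\<^sub>2\<^sup>2\<close>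
  cancel, and what remains is \<open>k\<^sub>1 k\<^sub>2\<close> times its polarization
  \<open>T\<^sub>1(u) \<cdot> T\<^sub>2(v) + T\<^sub>2(u) \<cdot> T\<^sub>1(v)
     = T\<^sub>1(\<rho>(T\<^sub>2(u))(v) + \<mu>(T\<^sub>2(v))(u)) + T\<^sub>2(\<rho>(T\<^sub>1(u))(v) + \<mu>(T\<^sub>1(v))(u))\<close>.
  Hence compatibility follows from this mixed identity
  (\<open>compatible_O_operators_if_mixed_identity\<close>).

  For \<open>T\<^sub>1 = T\<close> and \<open>T\<^sub>2 = N \<circ> T\<close>, the condition in the theorem is the mixed identity with \<open>N\<close>
  applied to both sides. It characterizes the \<open>\<O>\<close>-operators \<open>N \<circ> T\<close> because the Nijenhuis
  identity at \<open>T(u), T(v)\<close> turns \<open>NT(u) \<cdot> NT(v)\<close> into \<open>N\<close> of the left-hand side minus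
  \<open>N\<^sup>2(T(u) \<cdot> T(v))\<close>, where \<open>T(u) \<cdot> T(v)\<close> can be rewritten as \<open>T\<close> is an \<open>\<O>\<close>-operator
  (\<open>O_operator_nijenhuis_comp_iff\<close>). If \<open>N\<close> is injective it can be cancelled from the condition,
  which leaves the mixed identity itself.
\<close>

lemma O_operator_linear:
  "O_operator sg m sV \<rho> \<mu> T \<Longrightarrow> Vector_Spaces.linear sV sg T"
  by (simp add: O_operator_def)

lemma O_operatorD:
  "O_operator sg m sV \<rho> \<mu> T \<Longrightarrow> m (T u) (T v) = T (\<rho> (T u) v + \<mu> (T v) u)"
  by (simp add: O_operator_def)

lemma nijenhuis_operator_linear:
  "nijenhuis_operator s m N \<Longrightarrow> Vector_Spaces.linear s s N"
  by (simp add: nijenhuis_operator_def)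

lemma nijenhuis_operatorD:
  "nijenhuis_operator s m N \<Longrightarrow> m (N x) (N y) = N (m (N x) y + m x (N y) - N (m x y))"
  by (simp add: nijenhuis_operator_def)

lemma compatible_O_operators_if_mixed_identity:
  assumes m: "bilinear_map sg sg sg m"
    and \<rho>: "bilinear_map sg sV sV \<rho>" and \<mu>: "bilinear_map sg sV sV \<mu>"
    and T1: "O_operator sg m sV \<rho> \<mu> T1" and T2: "O_operator sg m sV \<rho> \<mu> T2"
    and mixed: "\<And>u v. m (T1 u) (T2 v) + m (T2 u) (T1 v) =
      T1 (\<rho> (T2 u) v + \<mu> (T2 v) u) + T2 (\<rho> (T1 u) v + \<mu> (T1 v) u)"
  shows "compatible_O_operators sg m sV \<rho> \<mu> T1 T2"
proof -
  interpret T1: Vector_Spaces.linear sV sg T1 using T1 by (rule O_operator_linear)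
  interpret T2: Vector_Spaces.linear sV sg T2 using T2 by (rule O_operator_linear)
  have "O_operator sg m sV \<rho> \<mu> (\<lambda>v. sg a (T1 v) + sg b (T2 v))" for a b
  proof -
    let ?S = "\<lambda>v. sg a (T1 v) + sg b (T2 v)"
    have "Vector_Spaces.linear sV sg ?S"
      by unfold_locales
        (simp_all add: T1.add T2.add T1.scale T2.scale T1.vs2.scale_right_distrib
          T1.vs2.scale_left_commute ac_simps)
    moreover have "m (?S u) (?S v) = ?S (\<rho> (?S u) v + \<mu> (?S v) u)" for u v
    proof -
      let ?w = "\<lambda>T. \<rho> (T u) v + \<mu> (T v) u"
      have "m (?S u) (?S v) = sg (a * a) (m (T1 u) (T1 v)) + sg (b * b) (m (T2 u) (T2 v))
          + sg (a * b) (m (T1 u) (T2 v) + m (T2 u) (T1 v))"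
        by (simp add: bilinear_mapD[OF m] T1.vs2.scale_right_distrib mult.commute ac_simps)
      also have "\<dots> = sg (a * a) (T1 (?w T1)) + sg (b * b) (T2 (?w T2))
          + sg (a * b) (T1 (?w T2) + T2 (?w T1))"
        by (simp only: mixed O_operatorD[OF T1] O_operatorD[OF T2])
      also have "\<dots> = ?S (sV a (?w T1) + sV b (?w T2))"
        by (simp add: T1.add T2.add T1.scale T2.scale T1.vs2.scale_right_distrib mult.commute
            ac_simps)
      also have "sV a (?w T1) + sV b (?w T2) = ?w ?S"
        by (simp add: bilinear_mapD[OF \<rho>] bilinear_mapD[OF \<mu>] T1.vs1.scale_right_distrib ac_simps)
      finally show ?thesis .
    qed
    ultimately show ?thesis by (simp add: O_operator_def)
  qed
  then show ?thesis using T1 T2 by (simp add: compatible_O_operators_def)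
qed

text \<open>
  Subtracting \<open>N\<^sup>2(T(u) \<cdot> T(v))\<close>, in its two forms, from both sides of the condition gives the
  \<open>\<O>\<close>-operator identity for \<open>N \<circ> T\<close>: on the left by the Nijenhuis identity, on the right by
  linearity of \<open>N\<close>.
\<close>

lemma O_operator_nijenhuis_comp_iff:
  assumes T: "O_operator sg m sV \<rho> \<mu> T" and N: "nijenhuis_operator sg m N"
  shows "O_operator sg m sV \<rho> \<mu> (N \<circ> T) \<longleftrightarrow>
    (\<forall>u v. N (m (N (T u)) (T v) + m (T u) (N (T v))) =
       N (T (\<rho> (N (T u)) v + \<mu> (N (T v)) u) + N (T (\<rho> (T u) v + \<mu> (T v) u))))"
proof -
  interpret N: Vector_Spaces.linear sg sg N using N by (rule nijenhuis_operator_linear)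
  have lin: "Vector_Spaces.linear sV sg (N \<circ> T)"
    using O_operator_linear[OF T] N.linear_axioms by (rule Vector_Spaces.linear_compose)
  have "m (N (T u)) (N (T v)) = N (m (N (T u)) (T v) + m (T u) (N (T v)))
      - N (N (T (\<rho> (T u) v + \<mu> (T v) u)))" for u v
    by (simp only: nijenhuis_operatorD[OF N] N.diff O_operatorD[OF T])
  then show ?thesis
    using lin by (simp add: O_operator_def N.add diff_eq_eq)
qed

lemma compatible_O_operators_inj_nijenhuis_comp:
  assumes m: "bilinear_map sg sg sg m"
    and \<rho>: "bilinear_map sg sV sV \<rho>" and \<mu>: "bilinear_map sg sV sV \<mu>"
    and T: "O_operator sg m sV \<rho> \<mu> T" and N: "nijenhuis_operator sg m N" and "inj N"
    and NT: "O_operator sg m sV \<rho> \<mu> (N \<circ> T)"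
  shows "compatible_O_operators sg m sV \<rho> \<mu> T (N \<circ> T)"
proof (rule compatible_O_operators_if_mixed_identity[OF m \<rho> \<mu> T NT])
  fix u v
  have "N (m (N (T u)) (T v) + m (T u) (N (T v))) =
      N (T (\<rho> (N (T u)) v + \<mu> (N (T v)) u) + N (T (\<rho> (T u) v + \<mu> (T v) u)))"
    using NT by (simp only: O_operator_nijenhuis_comp_iff[OF T N])
  with \<open>inj N\<close> show "m (T u) ((N \<circ> T) v) + m ((N \<circ> T) u) (T v) =
      T (\<rho> ((N \<circ> T) u) v + \<mu> ((N \<circ> T) v) u) + (N \<circ> T) (\<rho> (T u) v + \<mu> (T v) u)"
    by (simp add: inj_eq add.commute)
qed

theorem proposition5p10:
  fixes sg :: "'k::{alg_closed_field, field_char_0} \<Rightarrow> 'g::ab_group_add \<Rightarrow> 'g"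
    and sV :: "'k \<Rightarrow> 'v::ab_group_add \<Rightarrow> 'v"
    and Bg :: "'g set" and BV :: "'v set"
    and m :: "'g \<Rightarrow> 'g \<Rightarrow> 'g"
    and \<rho> \<mu> :: "'g \<Rightarrow> 'v \<Rightarrow> 'v"
    and T :: "'v \<Rightarrow> 'g" and N :: "'g \<Rightarrow> 'g"
  assumes "finite_dimensional_vector_space sg Bg"
    and "finite_dimensional_vector_space sV BV"
    and "pre_lie_algebra sg m"
    and "pre_lie_representation sg m sV \<rho> \<mu>"
    and "O_operator sg m sV \<rho> \<mu> T"
    and "nijenhuis_operator sg m N"
  shows "(O_operator sg m sV \<rho> \<mu> (N \<circ> T) \<longleftrightarrow>
           (\<forall>u v. N (m (N (T u)) (T v) + m (T u) (N (T v))) =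
                  N (T (\<rho> (N (T u)) v + \<mu> (N (T v)) u) + N (T (\<rho> (T u) v + \<mu> (T v) u)))))
         \<and> (O_operator sg m sV \<rho> \<mu> (N \<circ> T) \<longrightarrow> bij N \<longrightarrow>
              compatible_O_operators sg m sV \<rho> \<mu> T (N \<circ> T))
         \<and> (\<forall>T'. O_operator sg m sV \<rho> \<mu> T' \<longrightarrow>
              (\<forall>N'. nijenhuis_operator sg m N' \<and> bij N' \<and> O_operator sg m sV \<rho> \<mu> (N' \<circ> T') \<longrightarrow>
                 compatible_O_operators sg m sV \<rho> \<mu> T' (N' \<circ> T')))"
proof -
  have "bilinear_map sg sg sg m" "bilinear_map sg sV sV \<rho>" "bilinear_map sg sV sV \<mu>"
    using assms(3,4)
    by (simp_all add: pre_lie_algebra_def pre_lie_representation_def lie_representation_def)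
  note compat = compatible_O_operators_inj_nijenhuis_comp[OF this]
  show ?thesis
    using O_operator_nijenhuis_comp_iff[OF assms(5,6)] compat assms(5,6)
    by (blast intro: bij_is_inj)
qed

end
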